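(* Let $H=H(b,\delta,\lambda)$ be a balanced HST, let $W$ be a random $n$-element submultiset of its leaves, and let $h=\min(\delta,\log_b n)$. Then \[\mathbf{E}[M(W)]\le C_{b,\lambda}\sum_{k=1}^{h}(b\lambda)^k\] for some positive constant $C_{b,\lambda}$ depending only on $b$ and $\lambda$.
   Context: A balanced HST $H(b,\delta,\lambda)$ (integers $b\ge2$, $\delta\ge1$, real $0<\lambda<1$) is a rooted tree in which every non-leaf vertex has exactly $b$ children and every leaf is at depth $\delta$; the root is at level $0$, and each edge joining a vertex at level $\ell-1$ to a child at level $\ell$ has weight $\lambda^\ell$. The distance $d_H(x,y)$ is the total weight of the tree path between $x$ and $y$. A random $n$-element submultiset of the leaves is obtained by choosing $n$ leaves independently and uniformly at random (repetitions allowed); copies of the same leaf are treated as distinct points at distance $0$. For a finite multiset $V$ of leaves, $M(V)$ is the minimum of $\sum d_H(x,y)$ over all perfect matchings of the complete graph on $V$; if $|V|$ is odd, $M(V)$ is the minimum of $M(V\setminus\{x\})$ over $x\in V$. The sum ranges over integers $k$ with $1\le k\le h$.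
   Formalization: The formal theorem assumes n ≤ 1 or n ≥ b: for 2 ≤ n < b the sum over 1 ≤ k ≤ h is empty while E[M(W)] > 0 (e.g. b=3, δ=1, n=2 gives 4λ/3 > 0), so the inequality as stated fails in every excluded case. *)

theory Defs
  imports "HOL-Probability.Probability" "HOL-Library.Sublist"
begin

text \<open>
  The balanced HST with parameters \<open>b\<close>, \<open>\<delta>\<close>, \<open>lam\<close> is realised on words: a vertex at level \<open>l\<close> is a
  word of length \<open>l \<le> \<delta>\<close> over \<open>{..<b}\<close>, the root is the empty word and the children of \<open>u\<close> are
  the words \<open>u @ [i]\<close>.
\<close>

definition hst_vertices :: "nat \<Rightarrow> nat \<Rightarrow> nat list set" where
  "hst_vertices b \<delta> = {u. length u \<le> \<delta> \<and> set u \<subseteq> {..<b}}"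

definition hst_leaves :: "nat \<Rightarrow> nat \<Rightarrow> nat list set" where
  "hst_leaves b \<delta> = {u \<in> hst_vertices b \<delta>. length u = \<delta>}"

definition hst_adj :: "nat \<Rightarrow> nat \<Rightarrow> nat list \<Rightarrow> nat list \<Rightarrow> bool" where
  "hst_adj b \<delta> u v \<longleftrightarrow>
     u \<in> hst_vertices b \<delta> \<and> v \<in> hst_vertices b \<delta> \<and> (\<exists>i. v = u @ [i] \<or> u = v @ [i])"

text \<open>The weight of an edge is determined by the level of its lower endpoint.\<close>

definition hst_edge_weight :: "real \<Rightarrow> nat list \<Rightarrow> nat list \<Rightarrow> real" where
  "hst_edge_weight lam u v = lam ^ max (length u) (length v)"

definition hst_path :: "nat \<Rightarrow> nat \<Rightarrow> nat list \<Rightarrow> nat list \<Rightarrow> nat list list \<Rightarrow> bool" where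
  "hst_path b \<delta> x y p \<longleftrightarrow>
     p \<noteq> [] \<and> hd p = x \<and> last p = y \<and> distinct p \<and>
     set p \<subseteq> hst_vertices b \<delta> \<and> successively (hst_adj b \<delta>) p"

definition hst_path_weight :: "real \<Rightarrow> nat list list \<Rightarrow> real" where
  "hst_path_weight lam p = (\<Sum>i<length p - 1. hst_edge_weight lam (p ! i) (p ! Suc i))"

definition hst_dist :: "nat \<Rightarrow> nat \<Rightarrow> real \<Rightarrow> nat list \<Rightarrow> nat list \<Rightarrow> real" where
  "hst_dist b \<delta> lam x y = hst_path_weight lam (THE p. hst_path b \<delta> x y p)"

text \<open>
  A finite multiset of points is a family \<open>v\<close> indexed by a finite set \<open>I\<close>, so that equal points
  remain distinguishable. The edge between \<open>i\<close> and \<open>j\<close> in the complete graph on \<open>I\<close> is represented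
  by the pair \<open>(i, j)\<close> with \<open>i < j\<close>.
\<close>

definition perfect_matchings :: "'i::linorder set \<Rightarrow> ('i \<times> 'i) set set" where
  "perfect_matchings I =
     {E. E \<subseteq> {(i, j). i \<in> I \<and> j \<in> I \<and> i < j} \<and> (\<forall>k\<in>I. \<exists>!e. e \<in> E \<and> (k = fst e \<or> k = snd e))}"

definition matching_cost :: "('a \<Rightarrow> 'a \<Rightarrow> real) \<Rightarrow> ('i \<Rightarrow> 'a) \<Rightarrow> ('i \<times> 'i) set \<Rightarrow> real" where
  "matching_cost d v E = (\<Sum>(i, j)\<in>E. d (v i) (v j))"

definition min_perfect_matching ::
    "('a \<Rightarrow> 'a \<Rightarrow> real) \<Rightarrow> 'i::linorder set \<Rightarrow> ('i \<Rightarrow> 'a) \<Rightarrow> real" where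
  "min_perfect_matching d I v = Min (matching_cost d v ` perfect_matchings I)"

definition min_matching ::
    "('a \<Rightarrow> 'a \<Rightarrow> real) \<Rightarrow> 'i::linorder set \<Rightarrow> ('i \<Rightarrow> 'a) \<Rightarrow> real" where
  "min_matching d I v =
     (if even (card I) then min_perfect_matching d I v
      else Min ((\<lambda>x. min_perfect_matching d (I - {x}) v) ` I))"

definition random_leaves :: "nat \<Rightarrow> nat \<Rightarrow> nat \<Rightarrow> (nat \<Rightarrow> nat list) pmf" where
  "random_leaves b \<delta> n = Pi_pmf {..<n} [] (\<lambda>_. pmf_of_set (hst_leaves b \<delta>))"

definition expected_matching :: "nat \<Rightarrow> nat \<Rightarrow> real \<Rightarrow> nat \<Rightarrow> real" where
  "expected_matching b \<delta> lam n =
     measure_pmf.expectation (random_leaves b \<delta> n) (\<lambda>w. min_matching (hst_dist b \<delta> lam) {..<n} w)"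

text \<open>
  Pitfall: for \<open>2 \<le> n < b\<close> and \<open>\<delta> \<ge> 1\<close> no integer \<open>k \<ge> 1\<close> satisfies \<open>k \<le> log b n\<close>, so the
  sum of \<open>(b * lam) ^ k\<close> over \<open>1 \<le> k \<le> min \<delta> (log b n)\<close> is empty, whereas \<open>expected_matching\<close> is
  positive. An upper bound by a multiple of this sum is therefore only possible if \<open>n \<le> 1\<close> or
  \<open>b \<le> n\<close>.
\<close>


text \<open>Existence and uniqueness of tree paths, so that \<open>THE\<close> in \<open>hst_dist\<close> is meaningful.\<close>

lemma hst_adj_sym: "hst_adj b \<delta> u v \<Longrightarrow> hst_adj b \<delta> v u"
  unfolding hst_adj_def by auto

lemma hst_path_shorten:
  assumes "(hst_adj b \<delta>)\<^sup>*\<^sup>* x y" "y \<in> hst_vertices b \<delta>"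
  shows "\<exists>p. hst_path b \<delta> x y p"
  using assms
proof (induction rule: converse_rtranclp_induct)
  case base
  then show ?case by (intro exI[of _ "[y]"]) (auto simp: hst_path_def)
next
  case (step x z)
  then obtain p where p: "hst_path b \<delta> z y p" by blast
  show ?case
  proof (cases "x \<in> set p")
    case True
    then obtain as bs where "p = as @ x # bs" by (meson split_list)
    then have "hst_path b \<delta> x y (x # bs)"
      using p by (auto simp: hst_path_def successively_append_iff split: if_splits)
    then show ?thesis by blast
  next
    case False
    then have "hst_path b \<delta> x y (x # p)"
      using p step.hyps(1) by (auto simp: hst_path_def successively_Cons hst_adj_def)
    then show ?thesis by blast
  qed
qed

lemma hst_adj_root: "u \<in> hst_vertices b \<delta> \<Longrightarrow> (hst_adj b \<delta>)\<^sup>*\<^sup>* u []"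
proof (induction u rule: rev_induct)
  case (snoc i u)
  then have u: "u \<in> hst_vertices b \<delta>" by (auto simp: hst_vertices_def)
  with snoc have "hst_adj b \<delta> (u @ [i]) u" by (auto simp: hst_adj_def)
  with snoc.IH[OF u] show ?case by (meson converse_rtranclp_into_rtranclp)
qed simp

lemma hst_walk_stays_below:
  assumes "successively (hst_adj b \<delta>) (v # p)" "u \<notin> set p" "prefix (u @ [i]) v"
  shows "\<forall>w\<in>set (v # p). prefix (u @ [i]) w"
  using assms
proof (induction p arbitrary: v)
  case (Cons a p)
  have "hst_adj b \<delta> v a" using Cons.prems by simp
  then obtain k where "a = v @ [k] \<or> v = a @ [k]" by (auto simp: hst_adj_def)
  then have "prefix (u @ [i]) a"
    using Cons.prems(2,3) by auto
  with Cons.IH[of a] Cons.prems show ?case by auto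
qed simp

lemma hst_walk_stays_outside:
  assumes "successively (hst_adj b \<delta>) (v # p)" "c \<notin> set p" "\<not> prefix c v"
  shows "\<forall>w\<in>set (v # p). \<not> prefix c w"
  using assms
proof (induction p arbitrary: v)
  case (Cons a p)
  have "hst_adj b \<delta> v a" using Cons.prems by simp
  then obtain k where "a = v @ [k] \<or> v = a @ [k]" by (auto simp: hst_adj_def)
  then have "\<not> prefix c a"
    using Cons.prems(2,3) by auto
  with Cons.IH[of a] Cons.prems show ?case by auto
qed simp

lemma hst_path_first_step:
  assumes p: "hst_path b \<delta> x y (x # a # p)" and q: "hst_path b \<delta> x y (x # a' # q)"
    and a: "a = x @ [i]"
  shows "a = a'"
proof (rule ccontr)
  assume ne: "a \<noteq> a'"
  have "\<forall>w\<in>set (a # p). prefix (x @ [i]) w"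
    using p a by (intro hst_walk_stays_below[of b \<delta>]) (auto simp: hst_path_def)
  moreover have "y \<in> set (a # p)"
    using p by (auto simp: hst_path_def split: if_splits)
  ultimately have y: "prefix a y" using a by blast
  have yq: "y \<in> set (a' # q)"
    using q by (auto simp: hst_path_def split: if_splits)
  have "hst_adj b \<delta> x a'" using q by (simp add: hst_path_def)
  then obtain j where "a' = x @ [j] \<or> x = a' @ [j]" by (auto simp: hst_adj_def)
  then show False
  proof
    assume a': "a' = x @ [j]"
    have "\<forall>w\<in>set (a' # q). prefix (x @ [j]) w"
      using q a' by (intro hst_walk_stays_below[of b \<delta>]) (auto simp: hst_path_def)
    with yq have "prefix a' y" using a' by blast
    with y have "prefix a a' \<or> prefix a' a" by (meson prefix_same_cases)
    with a a' ne show False by auto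
  next
    assume x: "x = a' @ [j]"
    have "\<forall>w\<in>set (a' # q). \<not> prefix x w"
      using q x by (intro hst_walk_stays_outside[of b \<delta>]) (auto simp: hst_path_def)
    with yq have "\<not> prefix x y" by blast
    with y a show False by (auto simp: prefix_def)
  qed
qed

lemma hst_path_unique:
  assumes "hst_path b \<delta> x y p" "hst_path b \<delta> x y q"
  shows "p = q"
  using assms
proof (induction p arbitrary: x q)
  case Nil
  then show ?case by (simp add: hst_path_def)
next
  case (Cons x' p)
  have x': "x' = x" using Cons.prems by (simp add: hst_path_def)
  obtain q' where q: "q = x # q'"
    using Cons.prems(2) by (cases q) (auto simp: hst_path_def)
  have iff: "p = [] \<longleftrightarrow> y = x" "q' = [] \<longleftrightarrow> y = x"
    using Cons.prems x' q by (auto simp: hst_path_def split: if_splits)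
  show ?case
  proof (cases "y = x")
    case True
    then show ?thesis using iff x' q by simp
  next
    case False
    then obtain a r a' r' where r: "p = a # r" "q' = a' # r'"
      using iff by (metis list.exhaust)
    have P: "hst_path b \<delta> x y (x # a # r)" "hst_path b \<delta> x y (x # a' # r')"
      using Cons.prems x' q r by auto
    have "hst_adj b \<delta> x a" "hst_adj b \<delta> x a'" using P by (simp_all add: hst_path_def)
    then obtain i j where "a = x @ [i] \<or> x = a @ [i]" "a' = x @ [j] \<or> x = a' @ [j]"
      by (auto simp: hst_adj_def)
    then have "a = a'"
      using hst_path_first_step[OF P] hst_path_first_step[OF P(2,1)] by auto
    moreover have "hst_path b \<delta> a y p" "hst_path b \<delta> a' y q'"
      using P r by (auto simp: hst_path_def)
    ultimately show ?thesis using Cons.IH[of a q'] x' q by simp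
  qed
qed

lemma hst_path_ex1:
  assumes "x \<in> hst_vertices b \<delta>" "y \<in> hst_vertices b \<delta>"
  shows "\<exists>!p. hst_path b \<delta> x y p"
proof -
  have "symp (hst_adj b \<delta>)" by (auto intro: sympI hst_adj_sym)
  then have "(hst_adj b \<delta>)\<^sup>*\<^sup>* [] y"
    using hst_adj_root[OF assms(2)] by (metis symp_rtranclp sympD)
  with hst_adj_root[OF assms(1)] have "(hst_adj b \<delta>)\<^sup>*\<^sup>* x y" by simp
  from hst_path_shorten[OF this assms(2)] hst_path_unique show ?thesis by blast
qed

end

theory Submission
  imports Defs
begin

text \<open>
  The bound holds for every outcome, not only on average. Match greedily, always removing two
  remaining points with a longest common prefix. If such a pair differs in its prefix of length
  \<open>k\<close>, then all remaining points have distinct prefixes of length \<open>k\<close>, so at most \<open>b ^ k\<close> points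
  remain. Hence at most \<open>min (b ^ k) n\<close> matching edges cross level \<open>k\<close>, each contributing
  \<open>2 * lam ^ k\<close>. The levels up to \<open>h\<close> give the sum in question; beyond \<open>log b n\<close> the bound
  \<open>n * lam ^ k\<close> is a geometric series dominated by the term \<open>k = h\<close>.
\<close>

section \<open>Distances between leaves\<close>

lemma hst_path_weight_Cons:
  assumes "p \<noteq> []"
  shows "hst_path_weight lam (x # p) = hst_edge_weight lam x (hd p) + hst_path_weight lam p"
proof -
  obtain m where m: "length p = Suc m" using assms by (cases p) auto
  show ?thesis
    using assms by (simp add: hst_path_weight_def m sum.lessThan_Suc_shift hd_conv_nth del: sum.lessThan_Suc)
qed

lemma hst_path_weight_snoc:
  assumes "p \<noteq> []"
  shows "hst_path_weight lam (p @ [y]) = hst_path_weight lam p + hst_edge_weight lam (last p) y"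
proof -
  obtain m where m: "length p = Suc m" using assms by (cases p) auto
  show ?thesis
    using assms by (simp add: hst_path_weight_def m nth_append last_conv_nth)
qed

text \<open>These are the levels at which the ancestors of \<open>x\<close> and \<open>y\<close> are
  distinct vertices. The cutoff keeps the set finite, since \<open>take k\<close> is constant once
  \<open>k\<close> exceeds both lengths.\<close>

definition differing_levels :: "'a list \<Rightarrow> 'a list \<Rightarrow> nat set" where
  "differing_levels x y = {k. k \<le> max (length x) (length y) \<and> take k x \<noteq> take k y}"

text \<open>Induction on the level: a path between distinct vertices climbs from \<open>x\<close> to
  its parent, follows the path between the two parents, and descends to \<open>y\<close>. The two
  outer edges both have weight \<open>lam ^ m\<close>, whence the factor 2. The length bound
  strengthens the induction: it keeps \<open>x\<close> and \<open>y\<close> off the inner path, so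
  the extended path has no repetition.\<close>

lemma hst_path_same_level:
  assumes "length x = m" "length y = m" "x \<in> hst_vertices b \<delta>" "y \<in> hst_vertices b \<delta>"
  shows "\<exists>p. hst_path b \<delta> x y p \<and> (\<forall>u\<in>set p. length u \<le> m) \<and>
           hst_path_weight lam p = 2 * (\<Sum>k\<in>differing_levels x y. lam ^ k)"
  using assms
proof (induction m arbitrary: x y)
  case 0
  then show ?case
    by (intro exI[of _ "[x]"]) (auto simp: hst_path_def hst_path_weight_def differing_levels_def)
next
  case (Suc m)
  show ?case
  proof (cases "x = y")
    case True
    then show ?thesis using Suc.prems
      by (intro exI[of _ "[x]"]) (auto simp: hst_path_def hst_path_weight_def differing_levels_def)
  next
    case False
    obtain x' i where x: "x = x' @ [i]" "length x' = m"
      using Suc.prems(1) by (metis length_Suc_conv_rev)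
    obtain y' j where y: "y = y' @ [j]" "length y' = m"
      using Suc.prems(2) by (metis length_Suc_conv_rev)
    have V: "x' \<in> hst_vertices b \<delta>" "y' \<in> hst_vertices b \<delta>"
      using Suc.prems x y by (auto simp: hst_vertices_def)
    from Suc.IH[OF x(2) y(2) V] obtain p where p: "hst_path b \<delta> x' y' p"
      "\<forall>u\<in>set p. length u \<le> m"
      "hst_path_weight lam p = 2 * (\<Sum>k\<in>differing_levels x' y'. lam ^ k)" by blast
    have ne: "p \<noteq> []" and ends: "hd p = x'" "last p = y'" using p by (auto simp: hst_path_def)
    have out: "x \<notin> set p" "y \<notin> set p" using p(2) Suc.prems by fastforce+
    have adj: "hst_adj b \<delta> x x'" "hst_adj b \<delta> y' y"
      using V Suc.prems x y by (auto simp: hst_adj_def)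
    have path: "hst_path b \<delta> x y (x # p @ [y])"
      using p(1) ne ends out adj False Suc.prems(3,4)
      by (simp add: hst_path_def successively_Cons successively_append_iff)
    \<comment> \<open>Prefixes of length at most \<open>m\<close> are those of the parents, and at
      level \<open>Suc m\<close> the prefixes are the distinct words \<open>x\<close> and
      \<open>y\<close> themselves.\<close>
    have lv: "differing_levels x y = insert (Suc m) (differing_levels x' y')"
    proof (rule set_eqI)
      fix k
      show "k \<in> differing_levels x y \<longleftrightarrow> k \<in> insert (Suc m) (differing_levels x' y')"
        using x y False by (cases "k \<le> m"; cases "k = Suc m") (simp_all add: differing_levels_def)
    qed
    have fin: "finite (differing_levels x' y')" "Suc m \<notin> differing_levels x' y'"
      using x y by (auto simp: differing_levels_def)
    have "hst_path_weight lam (x # p @ [y]) = 2 * (\<Sum>k\<in>differing_levels x y. lam ^ k)"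
      using ne ends p(3) fin Suc.prems(1,2) x(2) y(2) unfolding lv
      by (simp add: hst_path_weight_Cons hst_path_weight_snoc hst_edge_weight_def algebra_simps)
    moreover have "\<forall>u\<in>set (x # p @ [y]). length u \<le> Suc m" using p(2) Suc.prems by auto
    ultimately show ?thesis using path by blast
  qed
qed

lemma hst_dist_leaves:
  assumes "x \<in> hst_leaves b \<delta>" "y \<in> hst_leaves b \<delta>"
  shows "hst_dist b \<delta> lam x y = 2 * (\<Sum>k | k \<in> {1..\<delta>} \<and> take k x \<noteq> take k y. lam ^ k)"
proof -
  have l: "length x = \<delta>" "length y = \<delta>" and V: "x \<in> hst_vertices b \<delta>" "y \<in> hst_vertices b \<delta>"
    using assms by (auto simp: hst_leaves_def)
  obtain p where p: "hst_path b \<delta> x y p"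
    "hst_path_weight lam p = 2 * (\<Sum>k\<in>differing_levels x y. lam ^ k)"
    using hst_path_same_level[OF l V] by blast
  have "(THE p. hst_path b \<delta> x y p) = p"
    using p(1) by (intro the_equality) (auto intro: hst_path_unique)
  \<comment> \<open>Level 0 drops out because all words share the empty prefix.\<close>
  moreover have "differing_levels x y = {k. k \<in> {1..\<delta>} \<and> take k x \<noteq> take k y}"
    using l by (auto simp: differing_levels_def Suc_le_eq intro: gr0I)
  ultimately show ?thesis using p(2) by (simp add: hst_dist_def)
qed

section \<open>Counting leaves and their prefixes\<close>

lemma hst_leaves_eq: "hst_leaves b \<delta> = {u. set u \<subseteq> {..<b} \<and> length u = \<delta>}"
  by (auto simp: hst_leaves_def hst_vertices_def)

lemma finite_hst_leaves: "finite (hst_leaves b \<delta>)"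
  unfolding hst_leaves_eq by (intro finite_lists_length_eq) simp

lemma hst_leaves_nonempty:
  assumes "b > 0"
  shows "hst_leaves b \<delta> \<noteq> {}"
proof -
  have "replicate \<delta> 0 \<in> hst_leaves b \<delta>" using assms by (auto simp: hst_leaves_eq)
  then show ?thesis by blast
qed

text \<open>Pigeonhole over the vertices of level \<open>k\<close>; \<open>k \<le> \<delta>\<close>
  ensures that each prefix has length exactly \<open>k\<close>.\<close>

lemma card_le_if_inj_on_take:
  assumes "inj_on (\<lambda>i. take k (v i)) I" "v ` I \<subseteq> hst_leaves b \<delta>" "k \<le> \<delta>"
  shows "card I \<le> b ^ k"
proof -
  have sub: "(\<lambda>i. take k (v i)) ` I \<subseteq> {u. set u \<subseteq> {..<b} \<and> length u = k}"
    using assms(2,3) by (force simp: hst_leaves_eq dest: in_set_takeD)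
  have "card I \<le> card {u. set u \<subseteq> {..<b} \<and> length u = k}"
    using card_inj_on_le[OF assms(1) sub] finite_lists_length_eq[of "{..<b}" k] by simp
  then show ?thesis by (simp add: card_lists_length_eq)
qed

section \<open>The greedy matching\<close>

lemma perfect_matchings_insert:
  assumes "i \<in> I" "j \<in> I" "i < j" "E \<in> perfect_matchings (I - {i, j})"
  shows "insert (i, j) E \<in> perfect_matchings I"
proof -
  have sub: "E \<subseteq> {(i', j'). i' \<in> I - {i, j} \<and> j' \<in> I - {i, j} \<and> i' < j'}"
    and ex: "\<forall>k\<in>I - {i, j}. \<exists>!e. e \<in> E \<and> (k = fst e \<or> k = snd e)"
    using assms(4) by (auto simp: perfect_matchings_def)
  have "\<exists>!e. e \<in> insert (i, j) E \<and> (k = fst e \<or> k = snd e)" if "k \<in> I" for k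
  proof (cases "k \<in> {i, j}")
    case True
    then show ?thesis using sub by (intro ex1I[of _ "(i, j)"]) auto
  next
    case False
    with ex that have "\<exists>!e. e \<in> E \<and> (k = fst e \<or> k = snd e)" by blast
    moreover have "e \<in> insert (i, j) E \<and> (k = fst e \<or> k = snd e)
        \<longleftrightarrow> e \<in> E \<and> (k = fst e \<or> k = snd e)" for e
      using False by auto
    ultimately show ?thesis by simp
  qed
  moreover have "insert (i, j) E \<subseteq> {(i, j). i \<in> I \<and> j \<in> I \<and> i < j}"
    using sub assms(1-3) by auto
  ultimately show ?thesis by (simp add: perfect_matchings_def)
qed

text \<open>For leaves \<open>v i\<close> and level \<open>k\<close> between 1 and \<delta>, the
  edges whose tree path uses two edges of weight \<open>lam ^ k\<close>.\<close>

definition crossing :: "('i \<Rightarrow> 'a list) \<Rightarrow> nat \<Rightarrow> ('i \<times> 'i) set \<Rightarrow> ('i \<times> 'i) set" where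
  "crossing v k E = {(i, j) \<in> E. take k (v i) \<noteq> take k (v j)}"

text \<open>Take the largest \<open>k \<le> \<delta>\<close> at which two points share a prefix, and
  a pair that agrees there. A level at which this pair differs lies above that maximum, so no two
  points agree at it.\<close>

lemma ex_pair_longest_common_prefix:
  fixes v :: "'i::linorder \<Rightarrow> 'a list"
  assumes "2 \<le> card I"
  shows "\<exists>i\<in>I. \<exists>j\<in>I. i < j \<and>
    (\<forall>k\<le>\<delta>. take k (v i) \<noteq> take k (v j) \<longrightarrow> inj_on (\<lambda>i. take k (v i)) I)"
proof -
  define P where "P = (\<lambda>k. k \<le> \<delta> \<and> \<not> inj_on (\<lambda>i. take k (v i)) I)"
  have "finite I" using assms by (metis card.infinite not_numeral_le_zero)
  then have "\<not> card I \<le> Suc 0 \<longrightarrow> (\<exists>i\<in>I. \<exists>j\<in>I. i \<noteq> j)"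
    using card_le_Suc0_iff_eq by blast
  \<comment> \<open>At length 0 all prefixes coincide, so any two points show that the maximum
    exists.\<close>
  then have "P 0" using assms by (auto simp: P_def inj_on_def)
  then have "P (Greatest P)"
    by (rule GreatestI_nat[where b = \<delta>]) (simp add: P_def)
  then obtain i j where "i \<in> I" "j \<in> I" "i \<noteq> j"
    and eq: "take (Greatest P) (v i) = take (Greatest P) (v j)"
    by (auto simp: P_def inj_on_def)
  then obtain i j where ij: "i \<in> I" "j \<in> I" "i < j"
    and eq: "take (Greatest P) (v i) = take (Greatest P) (v j)"
    by (metis linorder_neqE)
  have "inj_on (\<lambda>i. take k (v i)) I" if k: "k \<le> \<delta>" "take k (v i) \<noteq> take k (v j)" for k
  proof (rule ccontr)
    assume "\<not> inj_on (\<lambda>i. take k (v i)) I"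
    with k have "P k" by (simp add: P_def)
    then have "k \<le> Greatest P"
      by (rule Greatest_le_nat[where b = \<delta>]) (simp add: P_def)
    with eq have "take k (v i) = take k (v j)"
      by (metis min.absorb1 take_take)
    with k show False by simp
  qed
  with ij show ?thesis by blast
qed

text \<open>The greedy pair is chosen first and the induction hypothesis matches the rest. At levels
  that the pair does not cross, the count is inherited. At a level that it does cross, all points of
  \<open>I\<close> have distinct prefixes, so even the number of all edges is small enough.\<close>

lemma greedy_matching:
  fixes v :: "'i::linorder \<Rightarrow> nat list"
  assumes "finite I" "card I = 2 * m" "v ` I \<subseteq> hst_leaves b \<delta>"
  shows "\<exists>E\<in>perfect_matchings I. finite E \<and> card E \<le> m \<and>
    (\<forall>k\<le>\<delta>. card (crossing v k E) \<le> b ^ k)"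
  using assms
proof (induction m arbitrary: I)
  case 0
  then show ?case by (intro bexI[of _ "{}"]) (auto simp: perfect_matchings_def crossing_def)
next
  case (Suc m)
  then obtain i j where ij: "i \<in> I" "j \<in> I" "i < j"
    and inj: "\<And>k. k \<le> \<delta> \<Longrightarrow> take k (v i) \<noteq> take k (v j) \<Longrightarrow> inj_on (\<lambda>i. take k (v i)) I"
    using ex_pair_longest_common_prefix[of I \<delta> v] by auto
  have "card (I - {i, j}) = 2 * m" using Suc.prems ij by (simp add: card_Diff_subset)
  with Suc.IH[of "I - {i, j}"] Suc.prems obtain E where
    E: "E \<in> perfect_matchings (I - {i, j})" "finite E" "card E \<le> m"
      "\<And>k. k \<le> \<delta> \<Longrightarrow> card (crossing v k E) \<le> b ^ k"
    by (auto simp: image_subset_iff)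
  let ?E = "insert (i, j) E"
  have cE: "card ?E \<le> Suc m" using E by (simp add: card_insert_if)
  have "card (crossing v k ?E) \<le> b ^ k" if k: "k \<le> \<delta>" for k
  proof (cases "take k (v i) = take k (v j)")
    case True
    then have "crossing v k ?E = crossing v k E" by (auto simp: crossing_def)
    then show ?thesis using E(4) k by simp
  next
    case False
    have "card (crossing v k ?E) \<le> card ?E"
      using E(2) by (intro card_mono) (auto simp: crossing_def)
    also have "\<dots> \<le> card I" using cE Suc.prems by simp
    also have "\<dots> \<le> b ^ k"
      using card_le_if_inj_on_take inj[OF k False] Suc.prems(3) k by blast
    finally show ?thesis .
  qed
  then show ?case
    using perfect_matchings_insert[OF ij E(1)] E(2) cE by (intro bexI[of _ ?E]) auto
qed

section \<open>Cost of a matching, level by level\<close>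

lemma matching_cost_hst_dist:
  assumes "finite E" "E \<subseteq> I \<times> I" "v ` I \<subseteq> hst_leaves b \<delta>"
  shows "matching_cost (hst_dist b \<delta> lam) v E
    = 2 * (\<Sum>k=1..\<delta>. real (card (crossing v k E)) * lam ^ k)"
proof -
  have "matching_cost (hst_dist b \<delta> lam) v E
    = (\<Sum>e\<in>E. 2 * (\<Sum>k=1..\<delta>. if e \<in> crossing v k E then lam ^ k else 0))"
    unfolding matching_cost_def
  proof (intro sum.cong refl, clarify)
    fix i j assume e: "(i, j) \<in> E"
    then have "v i \<in> hst_leaves b \<delta>" "v j \<in> hst_leaves b \<delta>" using assms by auto
    from hst_dist_leaves[OF this, of lam] e
    show "hst_dist b \<delta> lam (v i) (v j)
      = 2 * (\<Sum>k=1..\<delta>. if (i, j) \<in> crossing v k E then lam ^ k else 0)"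
      by (simp add: crossing_def sum.If_cases Int_def)
  qed
  \<comment> \<open>Double counting: summing over levels first turns the cost into the numbers of
    crossing edges.\<close>
  also have "\<dots> = 2 * (\<Sum>k=1..\<delta>. \<Sum>e\<in>E. if e \<in> crossing v k E then lam ^ k else 0)"
    by (subst sum.swap) (simp add: sum_distrib_left)
  also have "(\<lambda>k. \<Sum>e\<in>E. if e \<in> crossing v k E then lam ^ k else 0)
      = (\<lambda>k. real (card (crossing v k E)) * lam ^ k)"
  proof
    fix k
    have "E \<inter> crossing v k E = crossing v k E" by (auto simp: crossing_def)
    then show "(\<Sum>e\<in>E. if e \<in> crossing v k E then lam ^ k else 0)
      = real (card (crossing v k E)) * lam ^ k"
      using assms(1) by (simp add: sum.If_cases)
  qed
  finally show ?thesis .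
qed

lemma finite_perfect_matchings:
  assumes "finite I"
  shows "finite (perfect_matchings I)"
proof -
  have "perfect_matchings I \<subseteq> Pow (I \<times> I)" by (auto simp: perfect_matchings_def)
  then show ?thesis using assms by (meson finite_Pow_iff finite_SigmaI finite_subset)
qed

lemma min_perfect_matching_le:
  assumes "finite I" "card I = 2 * m" "v ` I \<subseteq> hst_leaves b \<delta>" "0 \<le> lam"
  shows "min_perfect_matching (hst_dist b \<delta> lam) I v
    \<le> 2 * (\<Sum>k=1..\<delta>. real (min (b ^ k) m) * lam ^ k)"
proof -
  obtain E where E: "E \<in> perfect_matchings I" "finite E" "card E \<le> m"
    "\<And>k. k \<le> \<delta> \<Longrightarrow> card (crossing v k E) \<le> b ^ k"
    using greedy_matching[OF assms(1-3)] by blast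
  have "min_perfect_matching (hst_dist b \<delta> lam) I v \<le> matching_cost (hst_dist b \<delta> lam) v E"
    unfolding min_perfect_matching_def
    using E(1) finite_perfect_matchings[OF assms(1)] by (intro Min_le) auto
  also have "\<dots> = 2 * (\<Sum>k=1..\<delta>. real (card (crossing v k E)) * lam ^ k)"
    using E assms(3) by (intro matching_cost_hst_dist) (auto simp: perfect_matchings_def)
  also have "\<dots> \<le> 2 * (\<Sum>k=1..\<delta>. real (min (b ^ k) m) * lam ^ k)"
  proof (intro mult_left_mono sum_mono mult_right_mono)
    fix k assume k: "k \<in> {1..\<delta>}"
    have "card (crossing v k E) \<le> card E"
      using E(2) by (intro card_mono) (auto simp: crossing_def)
    then have "card (crossing v k E) \<le> min (b ^ k) m"
      using E(3) E(4)[of k] k by auto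
    then show "real (card (crossing v k E)) \<le> real (min (b ^ k) m)" by linarith
  qed (use assms in auto)
  finally show ?thesis .
qed

lemma min_matching_le:
  assumes "finite I" "v ` I \<subseteq> hst_leaves b \<delta>" "0 \<le> lam"
  shows "min_matching (hst_dist b \<delta> lam) I v
    \<le> 2 * (\<Sum>k=1..\<delta>. real (min (b ^ k) (card I div 2)) * lam ^ k)"
proof (cases "even (card I)")
  case True
  then show ?thesis
    using min_perfect_matching_le[of I "card I div 2" v b \<delta> lam] assms
    by (simp add: min_matching_def)
next
  case False
  then obtain x where x: "x \<in> I" by fastforce
  have c: "card (I - {x}) = 2 * (card I div 2)" using False x by auto
  \<comment> \<open>The minimum over removed points is at most the value for an arbitrary
    \<open>x\<close>, and removing \<open>x\<close> leaves \<open>card I div 2\<close>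
    pairs.\<close>
  have "min_matching (hst_dist b \<delta> lam) I v \<le> min_perfect_matching (hst_dist b \<delta> lam) (I - {x}) v"
    using False x assms(1) by (auto simp: min_matching_def intro: Min_le)
  also have "\<dots> \<le> 2 * (\<Sum>k=1..\<delta>. real (min (b ^ k) (card I div 2)) * lam ^ k)"
    using assms by (intro min_perfect_matching_le c) auto
  finally show ?thesis .
qed

section \<open>The expected cost\<close>

text \<open>The bound depends on the outcome only through \<open>n\<close>, so it passes to the
  expectation; the finite support gives integrability.\<close>

lemma expected_matching_le:
  assumes "b > 0" "0 \<le> lam"
  shows "expected_matching b \<delta> lam n \<le> 2 * (\<Sum>k=1..\<delta>. real (min (b ^ k) (n div 2)) * lam ^ k)"
    (is "_ \<le> ?B")
proof -
  let ?W = "random_leaves b \<delta> n" and ?f = "\<lambda>w. min_matching (hst_dist b \<delta> lam) {..<n} w"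
  have W: "set_pmf ?W = PiE_dflt {..<n} [] (\<lambda>_. hst_leaves b \<delta>)"
    using hst_leaves_nonempty[OF assms(1)] finite_hst_leaves
    by (simp add: random_leaves_def set_Pi_pmf o_def)
  then have "finite (set_pmf ?W)"
    by (simp add: finite_PiE_dflt finite_hst_leaves)
  moreover have "?f w \<le> ?B" if "w \<in> set_pmf ?W" for w
    using min_matching_le[of "{..<n}" w b \<delta> lam] that assms(2) W
    by (auto simp: PiE_dflt_def)
  ultimately show ?thesis
    unfolding expected_matching_def
    by (rule measure_pmf.integral_le_const[OF integrable_measure_pmf_finite AE_pmfI])
qed

section \<open>Comparing the levels beyond \<open>h\<close> with the sum up to
  \<open>h\<close>\<close>

lemma sum_power_tail_le:
  fixes x :: real
  assumes "0 \<le> x" "x < 1"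
  shows "(\<Sum>k\<in>{h<..d}. x ^ k) \<le> x ^ h / (1 - x)"
proof -
  have "x ^ Suc h \<le> x ^ h" using assms by (intro power_decreasing) auto
  then have "x ^ Suc h - x ^ Suc d \<le> x ^ h" using assms by (smt (verit) zero_le_power)
  then have "(x ^ Suc h - x ^ Suc d) / (1 - x) \<le> x ^ h / (1 - x)"
    using assms by (intro divide_right_mono) auto
  then show ?thesis
    using assms by (simp add: atLeastSucAtMost_greaterThanAtMost[symmetric] sum_gp del: power_Suc)
qed

theorem theorem3:
  fixes b :: nat and lam :: real
  assumes "b \<ge> 2" and "0 < lam" and "lam < 1"
  shows "\<exists>C>0. \<forall>\<delta>\<ge>1. \<forall>n::nat. (n \<le> 1 \<or> b \<le> n) \<longrightarrow>
           expected_matching b \<delta> lam n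
             \<le> C * (\<Sum>k | 1 \<le> k \<and> real k \<le> min (real \<delta>) (log (real b) (real n)). (real b * lam) ^ k)"
proof -
  \<comment> \<open>The tail beyond \<open>h\<close> will be at most
    \<open>b ^ (h + 1) * lam ^ h / (1 - lam)\<close>, which is \<open>D\<close> times the term
    \<open>k = h\<close>. In the final constant, 1 accounts for the levels up to \<open>h\<close>
    and \<open>D\<close> for the rest.\<close>
  define D where "D = real b / (1 - lam)"
  have D: "D > 0" using assms by (simp add: D_def)
  have "expected_matching b \<delta> lam n
      \<le> 2 * (1 + D) * (\<Sum>k | 1 \<le> k \<and> real k \<le> min (real \<delta>) (log (real b) (real n)). (real b * lam) ^ k)"
    (is "_ \<le> _ * ?S") if d: "\<delta> \<ge> 1" and n: "n \<le> 1 \<or> b \<le> n" for \<delta> n :: nat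
  proof (cases "n \<le> 1")
    case True
    then have "n div 2 = 0" by simp
    then have "expected_matching b \<delta> lam n \<le> 0"
      using expected_matching_le[of b lam \<delta> n] assms by simp
    \<comment> \<open>Only the sign of the sum enters, so the default value of \<open>log\<close> at
      0 is harmless when \<open>n = 0\<close>.\<close>
    also have "0 \<le> 2 * (1 + D) * ?S" using D assms by (intro mult_nonneg_nonneg sum_nonneg) auto
    finally show ?thesis .
  next
    case False
    with n assms(1) have bn: "b \<le> n" "n > 0" by auto
    \<comment> \<open>\<open>m\<close> is the integer part of the logarithm of \<open>n\<close> to
      base \<open>b\<close>.\<close>
    obtain m where m: "b ^ m \<le> n" "n < b ^ (m + 1)"
      using ex_power_ivl1[of b n] bn assms(1) by auto
    \<comment> \<open>Here \<open>b \<le> n\<close> is essential: it gives \<open>h \<ge> 1\<close>,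
      so that the term \<open>k = h\<close> that absorbs the tail really occurs in the sum.\<close>
    have "m \<noteq> 0" using m(2) bn(1) by (auto intro: ccontr)
    define h where "h = min \<delta> m"
    have h: "1 \<le> h" "h \<le> \<delta>" using d \<open>m \<noteq> 0\<close> by (auto simp: h_def)
    have log: "real k \<le> log (real b) (real n) \<longleftrightarrow> k \<le> m" for k
    proof -
      have "real k \<le> log (real b) (real n) \<longleftrightarrow> b ^ k \<le> n"
        using assms(1) bn(2) by (subst le_log_iff) (simp_all add: powr_realpow flip: of_nat_power)
      also have "\<dots> \<longleftrightarrow> k \<le> m"
        using m assms(1) power_increasing[of k m b] power_increasing[of "m + 1" k b]
        by (cases "k \<le> m") (simp_all del: power_increasing_iff power_Suc)
      finally show ?thesis .
    qed
    have S: "?S = (\<Sum>k=1..h. (real b * lam) ^ k)"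
      by (rule sum.cong) (auto simp: log h_def)
    have low: "(\<Sum>k=1..h. real (min (b ^ k) (n div 2)) * lam ^ k) \<le> ?S"
      unfolding S unfolding power_mult_distrib
      using assms by (intro sum_mono mult_right_mono) (auto simp flip: of_nat_power)
    have high: "(\<Sum>k\<in>{h<..\<delta>}. real (min (b ^ k) (n div 2)) * lam ^ k) \<le> D * ?S"
    proof (cases "h = \<delta>")
      case True
      then show ?thesis using D assms by (auto intro!: mult_nonneg_nonneg sum_nonneg)
    next
      case False
      \<comment> \<open>Levels beyond \<open>h\<close> exist only if the logarithm, not the depth,
        determines \<open>h\<close>; then \<open>n < b ^ (h + 1)\<close> caps every count.\<close>
      then have hm: "h = m" by (auto simp: h_def)
      have cap: "min (b ^ k) (n div 2) \<le> b ^ (h + 1)" for k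
        using m(2) unfolding hm by linarith
      have "(\<Sum>k\<in>{h<..\<delta>}. real (min (b ^ k) (n div 2)) * lam ^ k)
          \<le> (\<Sum>k\<in>{h<..\<delta>}. real (b ^ (h + 1)) * lam ^ k)"
        using assms cap by (intro sum_mono mult_right_mono of_nat_mono) auto
      also have "\<dots> \<le> real (b ^ (h + 1)) * (lam ^ h / (1 - lam))"
        unfolding sum_distrib_left[symmetric]
        using assms by (intro mult_left_mono sum_power_tail_le) auto
      also have "\<dots> = D * (real b * lam) ^ h" by (simp add: D_def power_mult_distrib)
      also have "\<dots> \<le> D * ?S"
        unfolding S using D h assms
        by (intro mult_left_mono member_le_sum[of h "{1..h}" "\<lambda>k. (real b * lam) ^ k"]) auto
      finally show ?thesis .
    qed
    have "{1..\<delta>} = {1..h} \<union> {h<..\<delta>}" using h by auto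
    then have split: "(\<Sum>k=1..\<delta>. real (min (b ^ k) (n div 2)) * lam ^ k)
      = (\<Sum>k=1..h. real (min (b ^ k) (n div 2)) * lam ^ k)
        + (\<Sum>k\<in>{h<..\<delta>}. real (min (b ^ k) (n div 2)) * lam ^ k)"
      by (simp only:) (rule sum.union_disjoint, auto)
    have "expected_matching b \<delta> lam n \<le> 2 * (\<Sum>k=1..\<delta>. real (min (b ^ k) (n div 2)) * lam ^ k)"
      using assms by (intro expected_matching_le) auto
    also have "\<dots> \<le> 2 * (?S + D * ?S)"
      unfolding split by (intro mult_left_mono add_mono low high) simp
    finally have "expected_matching b \<delta> lam n \<le> 2 * (?S + D * ?S)" .
    then show ?thesis by (simp add: algebra_simps)
  qed
  then show ?thesis using D by (intro exI[of _ "2 * (1 + D)"]) auto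
qed

end
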